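(* Let $S_1,\dots,S_q$ be a basis of a linear subspace $\mathcal S\subseteq\mathbb{R}^{m\times n}$, let $A=\sum_{i=1}^qa_iS_i\in\mathcal S$, and let $b\in\mathbb{R}^m$ be such that the genericity condition $\widetilde\sigma_n>\sigma_{n+1}$ holds. Let $x$ be the unique TLS solution, $r=b-Ax$, and $L\in\mathbb{R}^{k\times n}$ with $k\le n$. Then (with $Lx\ne0$ for the first formula) $$\kappa_{s,\infty}^{\mathrm{rel}}=\frac{\left\|\sum_{i=1}^q|a_i|\left|LQ_1QQ_1\left(\left[A^\top+\frac{2xr^\top}{1+x^\top x}\right]S_ix-S_i^\top r\right)\right|+\left|LQ_1QQ_1\left(A^\top+\frac{2xr^\top}{1+x^\top x}\right)\right||b|\right\|_\infty}{\|Lx\|_\infty},$$ $$\kappa_{s,c}=\left\|D_{Lx}^\dagger\sum_{i=1}^q|a_i|\left|LQ_1QQ_1\left(\left[A^\top+\frac{2xr^\top}{1+x^\top x}\right]S_ix-S_i^\top r\right)\right|+D_{Lx}^\dagger\left|LQ_1QQ_1\left(A^\top+\frac{2xr^\top}{1+x^\top x}\right)\right||b|\right\|_\infty,$$ where $Q_1=I_n+xx^\top$ and $Q=V_{11}D^{-1}V_{11}^\top$.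
   Context: Let $m>n$. The total least squares (TLS) problem for $A\in\mathbb{R}^{m\times n}$, $b\in\mathbb{R}^m$ is to minimize $\|[A,b]-[\widehat A,\widehat b]\|_F$ over $[\widehat A,\widehat b]\in\mathbb{R}^{m\times(n+1)}$ with $\widehat b$ in the range of $\widehat A$; any $x$ with $\widehat A x=\widehat b$ for a minimizer is a TLS solution. Let $\widetilde\sigma_n$ be the smallest singular value of $A$ and let $[A,b]=U\Sigma V^\top$ be an SVD with $U\in\mathbb{R}^{m\times m}$, $V\in\mathbb{R}^{(n+1)\times(n+1)}$ orthogonal and singular values $\sigma_1\ge\dots\ge\sigma_{n+1}\ge0$. Under the genericity condition $\widetilde\sigma_n>\sigma_{n+1}$ the TLS solution $x$ is unique and $\begin{bmatrix}x\\-1\end{bmatrix}=-\frac1{v_{n+1,n+1}}v_{n+1}$, where $v_{n+1}$ is the last column of $V$ and $v_{n+1,n+1}$ its last component. $V_{11}$ is the leading $n\times n$ submatrix of $V$ and $D=\mathrm{Diag}(\sigma_1^2-\sigma_{n+1}^2,\dots,\sigma_n^2-\sigma_{n+1}^2)$. With $P=A^\top A-\sigma_{n+1}^2I_n$, the structured mixed and componentwise condition numbers of $Lx$ are $\kappa_{s,\infty}^{\mathrm{rel}}=\|w\|_\infty/\|Lx\|_\infty$ and $\kappa_{s,c}=\|D_{Lx}^\dagger w\|_\infty$, where $$w=\sum_{i=1}^q|a_i|\left|LP^{-1}\left(\left[A^\top+\tfrac{2xr^\top}{1+x^\top x}\right]S_ix-S_i^\top r\right)\right|+\left|LP^{-1}\left[A^\top+\tfrac{2xr^\top}{1+x^\top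 x}\right]\right||b|.$$ $|\cdot|$ is the entrywise absolute value, $D_{Lx}$ is the diagonal matrix with diagonal $Lx$, and $\dagger$ is the Moore–Penrose inverse. *)

theory Defs
  imports "HOL-Analysis.Analysis"
begin

(* Row and column index types are linearly ordered, so that entries have positions 1, 2, ...
   (every dimension n \<ge> 1 is realised by such a type); the columns of [A, b] are indexed by 'n option, with None as the LAST position n + 1. *)

definition idx :: "'a::{finite,linorder} \<Rightarrow> nat" where
  "idx i = card {..i}"

definition aug_idx :: "('n::{finite,linorder}) option \<Rightarrow> nat" where
  "aug_idx j = (case j of None \<Rightarrow> CARD('n) + 1 | Some l \<Rightarrow> idx l)"

definition append_col :: "real^'n^'m \<Rightarrow> real^'m \<Rightarrow> real^('n option)^'m" where
  "append_col A b = (\<chi> i j. case j of None \<Rightarrow> b $ i | Some l \<Rightarrow> A $ i $ l)"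

definition leading_block :: "real^('n option)^('n option) \<Rightarrow> real^'n^'n" where
  "leading_block V = (\<chi> i j. V $ Some i $ Some j)"

definition diag_mat :: "real^'n \<Rightarrow> real^'n^'n" where
  "diag_mat v = (\<chi> i j. if i = j then v $ i else 0)"

definition outer :: "real^'m \<Rightarrow> real^'n \<Rightarrow> real^'n^'m" where
  "outer u v = (\<chi> i j. u $ i * v $ j)"

definition is_pinv :: "real^'n^'m \<Rightarrow> real^'m^'n \<Rightarrow> bool" where
  "is_pinv M X \<longleftrightarrow> M ** X ** M = M \<and> X ** M ** X = X
     \<and> transpose (M ** X) = M ** X \<and> transpose (X ** M) = X ** M"

definition pinv :: "real^'n^'m \<Rightarrow> real^'m^'n" where
  "pinv M = (THE X. is_pinv M X)"

(* The singular values of a matrix with at least as many rows as columns: the nonnegative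
   square roots of the eigenvalues of its Gram matrix. *)
definition singular_values :: "real^'n^'m \<Rightarrow> real set" where
  "singular_values M =
     {s. 0 \<le> s \<and> (\<exists>v. v \<noteq> 0 \<and> (transpose M ** M) *v v = s\<^sup>2 *\<^sub>R v)}"

definition smallest_singular_value :: "real^'n^'m \<Rightarrow> real" where
  "smallest_singular_value M = Min (singular_values M)"

definition rect_diag ::
    "(nat \<Rightarrow> real) \<Rightarrow> real^(('n::{finite,linorder}) option)^('m::{finite,linorder})" where
  "rect_diag \<sigma> = (\<chi> i j. if idx i = aug_idx j then \<sigma> (aug_idx j) else 0)"

(* Only meaningful for n + 1 \<le> m, when all n + 1 diagonal positions exist;
   only \<sigma> 1, ..., \<sigma> (n + 1) matter. *)
definition is_svd ::
    "real^(('n::{finite,linorder}) option)^('m::{finite,linorder})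
      \<Rightarrow> real^('m::{finite,linorder})^('m::{finite,linorder})
      \<Rightarrow> (nat \<Rightarrow> real) \<Rightarrow> real^('n option)^('n option) \<Rightarrow> bool" where
  "is_svd M U \<sigma> V \<longleftrightarrow>
     orthogonal_matrix U \<and> orthogonal_matrix V
     \<and> M = U ** rect_diag \<sigma> ** transpose V
     \<and> (\<forall>i j. 1 \<le> i \<and> i \<le> j \<and> j \<le> CARD('n) + 1 \<longrightarrow> \<sigma> j \<le> \<sigma> i)
     \<and> 0 \<le> \<sigma> (CARD('n) + 1)"

(* norm on matrices, viewed as vectors of vectors, is the Frobenius norm. *)
definition is_tls_minimizer ::
    "real^'n^'m \<Rightarrow> real^'m \<Rightarrow> real^'n^'m \<Rightarrow> real^'m \<Rightarrow> bool" where
  "is_tls_minimizer A b Ah bh \<longleftrightarrow>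
     bh \<in> range ((*v) Ah)
     \<and> (\<forall>A' b'. b' \<in> range ((*v) A') \<longrightarrow>
          norm (append_col A b - append_col Ah bh) \<le> norm (append_col A b - append_col A' b'))"

definition is_tls_solution :: "real^'n^'m \<Rightarrow> real^'m \<Rightarrow> real^'n \<Rightarrow> bool" where
  "is_tls_solution A b x \<longleftrightarrow> (\<exists>Ah bh. is_tls_minimizer A b Ah bh \<and> Ah *v x = bh)"

(* The vector w underlying the structured condition numbers of L x, where A is the sum of the
   a i *\<^sub>R S i (i = 1, ..., q) and s stands for \<sigma>_(n+1). Here \<bar>_\<bar> of a vector or
   matrix is the entrywise absolute value and infnorm below is the maximum norm. *)
definition tls_w ::
    "real^'n^'k \<Rightarrow> nat \<Rightarrow> (nat \<Rightarrow> real^'n^'m) \<Rightarrow> (nat \<Rightarrow> real) \<Rightarrow> real^'n^'m \<Rightarrow> real^'m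
      \<Rightarrow> real \<Rightarrow> real^'n \<Rightarrow> real^'k" where
  "tls_w L q S a A b s x =
     (let r = b - A *v x;
          P = transpose A ** A - s\<^sup>2 *\<^sub>R mat 1;
          K = transpose A + (2 / (1 + x \<bullet> x)) *\<^sub>R outer x r
      in (\<Sum>i=1..q. \<bar>a i\<bar> *\<^sub>R
            \<bar>(L ** matrix_inv P) *v (K *v (S i *v x) - transpose (S i) *v r)\<bar>)
         + \<bar>L ** matrix_inv P ** K\<bar> *v \<bar>b\<bar>)"

definition kappa_s_inf_rel ::
    "real^'n^'k \<Rightarrow> nat \<Rightarrow> (nat \<Rightarrow> real^'n^'m) \<Rightarrow> (nat \<Rightarrow> real) \<Rightarrow> real^'n^'m \<Rightarrow> real^'m
      \<Rightarrow> real \<Rightarrow> real^'n \<Rightarrow> real" where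
  "kappa_s_inf_rel L q S a A b s x = infnorm (tls_w L q S a A b s x) / infnorm (L *v x)"

definition kappa_s_c ::
    "real^'n^'k \<Rightarrow> nat \<Rightarrow> (nat \<Rightarrow> real^'n^'m) \<Rightarrow> (nat \<Rightarrow> real) \<Rightarrow> real^'n^'m \<Rightarrow> real^'m
      \<Rightarrow> real \<Rightarrow> real^'n \<Rightarrow> real" where
  "kappa_s_c L q S a A b s x = infnorm (pinv (diag_mat (L *v x)) *v tls_w L q S a A b s x)"

end

theory Submission
  imports Defs
begin

text \<open>
  Both formulas follow from one matrix identity. Write \<open>C = [A, b]\<close>, \<open>s\<close> for the smallest
  singular value of \<open>C\<close>, \<open>W\<close> for the leading block of \<open>V\<close> and \<open>Q\<^sub>1 = I + x x\<^sup>T\<close>. Then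
  \<open>P = A\<^sup>T A - s\<^sup>2 I\<close> satisfies \<open>P\<^sup>-\<^sup>1 = Q\<^sub>1 (W D\<^sup>-\<^sup>1 W\<^sup>T) Q\<^sub>1\<close>, and it remains to put this
  into \<open>tls_w\<close> and to distribute the pseudoinverse over a sum.

  The identity has two halves. First, \<open>C\<^sup>T C - s\<^sup>2 I\<close> is diagonalised by \<open>V\<close> and its last
  eigenvalue is \<open>0\<close>. The last column of \<open>V\<close> therefore drops out, and comparing leading blocks
  gives \<open>P = W D W\<^sup>T\<close> (\<open>leading_block_shifted\<close>). The genericity condition keeps \<open>s\<^sup>2\<close> from being
  an eigenvalue of \<open>A\<^sup>T A\<close>, so \<open>P\<close>, and with it \<open>W\<close> and \<open>D\<close>, is invertible. Since
  the diagonal of \<open>D\<close> is nonnegative by the ordering of the singular values, it is even positive,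
  so \<open>s\<^sup>2\<close> is a simple eigenvalue of \<open>C\<^sup>T C\<close>.

  Second, \<open>W\<^sup>T Q\<^sub>1 W = I\<close> (\<open>bordered_inverse\<close>), that is, \<open>W\<^sup>-\<^sup>1 = W\<^sup>T Q\<^sub>1\<close>. The columns of \<open>V\<close>
  are orthonormal, so \<open>W\<^sup>T W + w w\<^sup>T = I\<close> for the rest \<open>w\<close> of the last row of \<open>V\<close>, and
  the claim amounts to \<open>W\<^sup>T x = \<plusminus>w\<close>. This is orthogonality of the last column of \<open>V\<close> to the
  others, once \<open>(x, -1)\<close> is known to be a multiple of that column.

  That multiple comes from minimality. A feasible \<open>[A', b']\<close> solved by \<open>x\<close> annihilates
  \<open>z = (x, -1)\<close>, so its distance to \<open>C\<close> is at least \<open>\<parallel>C z\<parallel> / \<parallel>z\<parallel>\<close>. On the other hand, the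
  rank-one correction \<open>C - C v v\<^sup>T\<close> along the last column \<open>v\<close> is feasible and has distance
  \<open>\<parallel>C v\<parallel> = s\<close> (\<open>tls_solution_minimises_quotient\<close>). Thus \<open>z\<close> minimises the Rayleigh quotient of
  \<open>C\<^sup>T C\<close>, whose least eigenvalue is simple (\<open>bottom_eigenspace\<close>).
\<close>

section \<open>Positions and borders\<close>

lemma idx_strict_mono: "i < j \<Longrightarrow> idx i < idx (j :: 'a::{finite,linorder})"
  unfolding idx_def by (rule psubset_card_mono) auto

lemma inj_idx: "inj (idx :: 'a::{finite,linorder} \<Rightarrow> nat)"
  by (rule injI) (metis idx_strict_mono less_irrefl neq_iff)

lemma range_idx: "range (idx :: 'a::{finite,linorder} \<Rightarrow> nat) = {1..CARD('a)}"
proof (rule card_subset_eq)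
  show "range (idx :: 'a \<Rightarrow> nat) \<subseteq> {1..CARD('a)}"
    by (auto simp: idx_def card_mono Suc_le_eq card_gt_0_iff)
  show "card (range (idx :: 'a \<Rightarrow> nat)) = card {1..CARD('a)}"
    using card_image[OF inj_idx[where 'a='a]] by simp
qed simp

lemma idx_bounds: "1 \<le> idx (i :: 'a::{finite,linorder})" "idx i \<le> CARD('a)"
  using range_idx[where 'a='a] by auto

lemma inj_aug_idx: "inj (aug_idx :: 'n::{finite,linorder} option \<Rightarrow> nat)"
proof (rule injI)
  fix j k :: "'n option"
  assume "aug_idx j = aug_idx k"
  moreover have "idx l \<noteq> Suc CARD('n)" for l :: 'n
    using idx_bounds(2)[of l] by linarith
  ultimately show "j = k"
    using inj_idx[where 'a='n]
    by (cases j; cases k) (auto simp: aug_idx_def inj_eq eq_commute[of "Suc _"])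
qed

lemma aug_idx_bounds:
  "1 \<le> aug_idx (j :: 'n::{finite,linorder} option)" "aug_idx j \<le> CARD('n) + 1"
  using idx_bounds[where 'a='n] by (cases j; auto simp: aug_idx_def le_SucI)+

lemma sum_UNIV_option:
  "(\<Sum>j\<in>UNIV. f j) = f None + (\<Sum>l\<in>(UNIV :: 'n::finite set). f (Some l))"
proof -
  have "(\<Sum>j\<in>range Some. f j) = (\<Sum>l\<in>(UNIV :: 'n set). f (Some l))"
    by (subst sum.reindex) auto
  then show ?thesis
    by (simp add: UNIV_option_conv)
qed

definition border :: "real^'n \<Rightarrow> real \<Rightarrow> real^('n option)" where
  "border x t = (\<chi> j. case j of None \<Rightarrow> t | Some l \<Rightarrow> x $ l)"

lemma border_nth [simp]: "border x t $ None = t" "border x t $ Some l = x $ l"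
  by (simp_all add: border_def)

lemma append_col_mult_border: "append_col A b *v border x t = A *v x + t *\<^sub>R b"
  by (simp add: vec_eq_iff matrix_vector_mult_def append_col_def sum_UNIV_option)

lemma leading_block_gram_append_col:
  "leading_block (transpose (append_col A b) ** append_col A b) = transpose A ** A"
  by (simp add: vec_eq_iff leading_block_def matrix_matrix_mult_def transpose_def append_col_def)

section \<open>Diagonal matrices and the Gram matrix of a singular value decomposition\<close>

lemma matrix_mult_diag_mat_nth: "(M ** diag_mat d) $ i $ j = M $ i $ j * d $ j"
  by (simp add: matrix_matrix_mult_def diag_mat_def mult_delta_right)

lemma diag_mat_mult_vector_nth: "(diag_mat d *v y) $ i = d $ i * y $ i"
  by (simp add: matrix_vector_mult_def diag_mat_def mult_delta_left)

lemma congruence_diag_mat_nth: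
  "(V ** diag_mat d ** transpose W) $ i $ k = (\<Sum>j\<in>UNIV. V $ i $ j * d $ j * W $ k $ j)"
  by (subst matrix_matrix_mult_def) (simp add: matrix_mult_diag_mat_nth transpose_def)

text \<open>
  Every diagonal position must exist, which is where more rows than unknowns are required: with
  too few rows, the last singular values would have no place in the rectangular diagonal.
\<close>

lemma gram_rect_diag:
  fixes \<sigma> :: "nat \<Rightarrow> real"
  defines "R \<equiv> rect_diag \<sigma> :: real^('n::{finite,linorder} option)^('m::{finite,linorder})"
  assumes "CARD('m) > CARD('n)"
  shows "transpose R ** R = diag_mat (\<chi> j. (\<sigma> (aug_idx j))\<^sup>2)"
proof -
  have "(transpose R ** R) $ j $ k = diag_mat (\<chi> j. (\<sigma> (aug_idx j))\<^sup>2) $ j $ k" for j k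
  proof -
    have "aug_idx j \<in> range (idx :: 'm \<Rightarrow> nat)"
      using range_idx[where 'a='m] aug_idx_bounds[of j] assms by auto
    then obtain i0 :: 'm where i0: "idx i0 = aug_idx j" by auto
    have pos: "idx i = aug_idx j \<longleftrightarrow> i = i0" for i :: 'm
      using i0 inj_idx[where 'a='m] by (metis injD)
    have "(transpose R ** R) $ j $ k = (\<Sum>i\<in>UNIV. R $ i $ j * R $ i $ k)"
      by (simp add: matrix_matrix_mult_def transpose_def)
    also have "\<dots> = (\<Sum>i\<in>UNIV. if i = i0 then \<sigma> (aug_idx j) * R $ i0 $ k else 0)"
      by (rule sum.cong) (auto simp: R_def rect_diag_def pos)
    also have "\<dots> = \<sigma> (aug_idx j) * R $ i0 $ k" by simp
    also have "\<dots> = diag_mat (\<chi> j. (\<sigma> (aug_idx j))\<^sup>2) $ j $ k"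
      using inj_aug_idx[where 'n='n]
      by (auto simp: R_def rect_diag_def diag_mat_def i0 power2_eq_square inj_eq)
    finally show ?thesis .
  qed
  then show ?thesis by (simp add: vec_eq_iff)
qed

lemma gram_svd:
  fixes M :: "real^('n::{finite,linorder} option)^('m::{finite,linorder})"
  assumes "CARD('m) > CARD('n)" and "is_svd M U \<sigma> V"
  shows "transpose M ** M = V ** diag_mat (\<chi> j. (\<sigma> (aug_idx j))\<^sup>2) ** transpose V"
proof -
  have U: "transpose U ** U = mat 1" and M: "M = U ** rect_diag \<sigma> ** transpose V"
    using assms(2) by (auto simp: is_svd_def orthogonal_matrix)
  have "transpose M ** M
      = V ** (transpose (rect_diag \<sigma>) ** (transpose U ** U) ** rect_diag \<sigma>) ** transpose V"
    unfolding M by (simp add: matrix_transpose_mul transpose_transpose matrix_mul_assoc)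
  then show ?thesis
    by (simp add: U gram_rect_diag[OF assms(1)])
qed

text \<open>
  Subtracting \<open>d $ None\<close> times the identity subtracts it from every eigenvalue. The eigenvalue
  that belongs to the last column becomes zero, so the leading block involves only the
  leading block of \<open>V\<close>.
\<close>

lemma leading_block_shifted:
  fixes V :: "real^('n::finite option)^('n option)"
  assumes V: "orthogonal_matrix V"
  shows "leading_block (V ** diag_mat d ** transpose V) - (d $ None) *\<^sub>R mat 1
         = leading_block V ** diag_mat (\<chi> j. d $ Some j - d $ None) ** transpose (leading_block V)"
proof -
  let ?G = "V ** diag_mat d ** transpose V"
  have "?G $ Some i $ Some k - d $ None * mat 1 $ i $ k
      = (\<Sum>j\<in>UNIV. V $ Some i $ Some j * (d $ Some j - d $ None) * V $ Some k $ Some j)" for i k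
  proof -
    have "V ** transpose V = mat 1" using V by (simp add: orthogonal_matrix_def)
    then have "(V ** transpose V) $ Some i $ Some k = mat 1 $ i $ k"
      by (simp add: mat_def)
    then have one: "mat 1 $ i $ k = (\<Sum>j\<in>UNIV. V $ Some i $ j * V $ Some k $ j)"
      by (simp add: matrix_matrix_mult_def transpose_def)
    have "?G $ Some i $ Some k - d $ None * mat 1 $ i $ k
        = (\<Sum>j\<in>UNIV. V $ Some i $ j * (d $ j - d $ None) * V $ Some k $ j)"
      unfolding one congruence_diag_mat_nth
      by (simp add: sum_distrib_left algebra_simps flip: sum_subtractf)
    then show ?thesis by (simp add: sum_UNIV_option)
  qed
  then show ?thesis
    by (simp add: vec_eq_iff congruence_diag_mat_nth leading_block_def)
qed

section \<open>Singular values\<close>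

lemma gram_inner: "(transpose M ** M *v u) \<bullet> w = (M *v u) \<bullet> (M *v (w :: real^'n))"
  by (simp add: dot_lmul_matrix transpose_matrix_vector flip: matrix_vector_mul_assoc)

text \<open>
  Eigenvectors of the symmetric matrix \<open>M\<^sup>T M\<close> for distinct eigenvalues are orthogonal, and a
  family of nonzero orthogonal vectors is finite. Finiteness is what makes the minimum in the
  smallest singular value a genuine lower bound.
\<close>

lemma finite_singular_values: "finite (singular_values (M :: real^'n^'m))"
proof -
  let ?G = "transpose M ** M"
  have "\<forall>s\<in>singular_values M. \<exists>v. v \<noteq> 0 \<and> ?G *v v = s\<^sup>2 *\<^sub>R v"
    by (auto simp: singular_values_def)
  then obtain f where f: "\<And>s. s \<in> singular_values M \<Longrightarrow> f s \<noteq> 0 \<and> ?G *v f s = s\<^sup>2 *\<^sub>R f s"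
    by metis
  have orth: "f s \<bullet> f t = 0" if "s \<in> singular_values M" "t \<in> singular_values M" "s \<noteq> t" for s t
  proof -
    have "s\<^sup>2 * (f s \<bullet> f t) = t\<^sup>2 * (f s \<bullet> f t)"
      using gram_inner[of M "f s" "f t"] gram_inner[of M "f t" "f s"] f[OF that(1)] f[OF that(2)]
      by (simp add: inner_commute)
    moreover have "s\<^sup>2 \<noteq> t\<^sup>2"
      using that by (auto simp: singular_values_def power2_eq_iff_nonneg)
    ultimately show ?thesis by simp
  qed
  have "inj_on f (singular_values M)"
    by (rule inj_onI) (metis f orth inner_eq_zero_iff)
  moreover have "finite (f ` singular_values M)"
    by (rule pairwise_orthogonal_imp_finite)
       (auto simp: pairwise_def orthogonal_def intro!: orth)
  ultimately show ?thesis
    by (simp add: finite_image_iff)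
qed

lemma invertible_shifted_gram:
  fixes M :: "real^'n^'m"
  assumes "0 \<le> s" and "s < smallest_singular_value M"
  shows "invertible (transpose M ** M - s\<^sup>2 *\<^sub>R mat 1)"
proof -
  have "y = 0" if "(transpose M ** M - s\<^sup>2 *\<^sub>R mat 1) *v y = 0" for y
  proof (rule ccontr)
    assume "y \<noteq> 0"
    moreover have "transpose M ** M *v y = s\<^sup>2 *\<^sub>R y"
      using that by (simp add: matrix_vector_mult_diff_rdistrib scaleR_matrix_vector_assoc[symmetric])
    ultimately have "s \<in> singular_values M"
      using assms(1) by (auto simp: singular_values_def)
    then have "smallest_singular_value M \<le> s"
      unfolding smallest_singular_value_def by (rule Min_le[OF finite_singular_values])
    with assms(2) show False by simp
  qed
  then show ?thesis
    by (simp add: invertible_left_inverse matrix_left_invertible_ker)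
qed

section \<open>The total least squares solution\<close>

text \<open>
  The Frobenius norm dominates the operator norm: Cauchy-Schwarz in each row.
\<close>

lemma norm_matrix_vector_mult_le: "norm (M *v z) \<le> norm M * norm (z :: real^'n)"
proof -
  have "norm (M *v z) = L2_set (\<lambda>i. norm ((M *v z) $ i)) UNIV"
    by (simp add: norm_vec_def)
  also have "\<dots> \<le> L2_set (\<lambda>i. norm (M $ i) * norm z) UNIV"
    by (rule L2_set_mono) (auto simp: matrix_vector_mul_component Cauchy_Schwarz_ineq2)
  also have "\<dots> = norm M * norm z"
    by (simp add: norm_vec_def L2_set_left_distrib)
  finally show ?thesis .
qed

lemma norm_outer: "norm (outer u v) = norm u * norm v"
proof -
  have "outer u v $ i = (u $ i) *\<^sub>R v" for i
    by (simp add: outer_def vec_eq_iff)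
  then have "norm (outer u v) = L2_set (\<lambda>i. norm (u $ i) * norm v) UNIV"
    by (subst norm_vec_def) simp
  also have "\<dots> = norm u * norm v"
    by (simp add: norm_vec_def L2_set_left_distrib)
  finally show ?thesis .
qed

lemma outer_mult_vector: "outer u v *v w = (v \<bullet> w) *\<^sub>R u"
  by (simp add: vec_eq_iff matrix_vector_mult_def outer_def inner_vec_def sum_distrib_right
      mult.assoc mult.commute[of _ "u $ _"] sum_distrib_left)

text \<open>
  The quotient \<open>\<parallel>C z\<parallel> / \<parallel>z\<parallel>\<close> at \<open>z = (x, -1)\<close> bounds the optimal distance from below, because the
  minimizer annihilates \<open>z\<close>. The matrix \<open>C - C v v\<^sup>T\<close> annihilates \<open>v\<close> and lies at distance
  \<open>\<parallel>C v\<parallel>\<close>; since the last component of \<open>v\<close> is nonzero, the resulting relation between its columns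
  can be solved for the last one, so that it is feasible and bounds the distance from above.
\<close>

lemma tls_solution_minimises_quotient:
  fixes A :: "real^'n^'m" and v :: "real^('n option)"
  assumes tls: "is_tls_solution A b x" and v: "norm v = 1" "v $ None \<noteq> 0"
  shows "norm (append_col A b *v border x (- 1))
         \<le> norm (append_col A b *v v) * norm (border x (- 1))"
proof -
  let ?C = "append_col A b" and ?z = "border x (- 1)"
  obtain Ah bh where min: "is_tls_minimizer A b Ah bh" and Ahx: "Ah *v x = bh"
    using tls by (auto simp: is_tls_solution_def)
  define C' where "C' = ?C - outer (?C *v v) v"
  define A' :: "real^'n^'m" where "A' = (\<chi> i l. C' $ i $ Some l)"
  define b' where "b' = (\<chi> i. C' $ i $ None)"
  define u where "u = (\<chi> l. v $ Some l)"
  have C': "append_col A' b' = C'"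
    by (auto simp: vec_eq_iff append_col_def A'_def b'_def split: option.split)
  have v_eq: "v = border u (v $ None)"
    by (auto simp: vec_eq_iff border_def u_def split: option.split)
  have "v \<bullet> v = 1" using v(1) by (simp add: norm_eq_1)
  then have "C' *v v = 0"
    by (simp add: C'_def matrix_vector_mult_diff_rdistrib outer_mult_vector)
  then have "A' *v u + (v $ None) *\<^sub>R b' = 0"
    using append_col_mult_border[of A' b' u "v $ None"] C' v_eq by simp
  then have "A' *v u = - (v $ None) *\<^sub>R b'"
    by (simp add: eq_neg_iff_add_eq_0)
  \<comment> \<open>Solving \<open>C' v = 0\<close> for the last column exhibits a feasible competitor.\<close>
  then have "A' *v ((- 1 / v $ None) *\<^sub>R u) = b'"
    using v(2) by (simp only: matrix_vector_mult_scaleR) simp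
  then have "b' \<in> range ((*v) A')" by (metis rangeI)
  then have "norm (?C - append_col Ah bh) \<le> norm (?C - C')"
    using min C' by (auto simp: is_tls_minimizer_def)
  also have "\<dots> = norm (?C *v v)"
    by (simp add: C'_def norm_outer v(1))
  finally have le: "norm (?C - append_col Ah bh) \<le> norm (?C *v v)" .
  have "append_col Ah bh *v ?z = 0"
    by (simp add: append_col_mult_border Ahx)
  then have "norm (?C *v ?z) = norm ((?C - append_col Ah bh) *v ?z)"
    by (simp add: matrix_vector_mult_diff_rdistrib)
  also have "\<dots> \<le> norm (?C - append_col Ah bh) * norm ?z"
    by (rule norm_matrix_vector_mult_le)
  also have "\<dots> \<le> norm (?C *v v) * norm ?z"
    by (rule mult_right_mono[OF le]) simp
  finally show ?thesis .
qed

text \<open>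
  In the coordinates \<open>y = V\<^sup>T z\<close> the hypothesis on \<open>z\<close> reads
  \<open>\<Sum>\<^sub>j (d\<^sub>j - d\<^sub>p) y\<^sub>j\<^sup>2 \<le> 0\<close>. All terms are nonnegative, so they vanish, and by the gap only
  the coordinate \<open>y\<^sub>p\<close> survives.
\<close>

lemma bottom_eigenspace:
  fixes M :: "real^'n^'m" and V :: "real^'n^'n"
  assumes gram: "transpose M ** M = V ** diag_mat d ** transpose V"
    and V: "orthogonal_matrix V"
    and gap: "\<And>j. j \<noteq> p \<Longrightarrow> d $ p < d $ j"
    and le: "norm (M *v z) \<le> norm (M *v column p V) * norm z"
  shows "z = ((transpose V *v z) $ p) *\<^sub>R column p V"
proof -
  have VtV: "transpose V ** V = mat 1" and VVt: "V ** transpose V = mat 1"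
    using V by (simp_all add: orthogonal_matrix_def)
  have adjoint: "(V *v u) \<bullet> w = u \<bullet> (transpose V *v w)" for u w
    by (simp add: dot_lmul_matrix[symmetric] transpose_matrix_vector inner_commute)
  have sq: "(norm (M *v w))\<^sup>2 = (\<Sum>j\<in>UNIV. d $ j * ((transpose V *v w) $ j)\<^sup>2)" for w
  proof -
    have "(norm (M *v w))\<^sup>2 = (transpose M ** M *v w) \<bullet> w"
      by (simp add: gram_inner power2_norm_eq_inner)
    also have "\<dots> = (V *v (diag_mat d *v (transpose V *v w))) \<bullet> w"
      by (simp add: gram flip: matrix_vector_mul_assoc)
    also have "\<dots> = (diag_mat d *v (transpose V *v w)) \<bullet> (transpose V *v w)"
      by (rule adjoint)
    finally show ?thesis
      by (simp add: inner_vec_def diag_mat_mult_vector_nth power2_eq_square mult.assoc)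
  qed
  define y where "y = transpose V *v z"
  have col: "V *v axis p 1 = column p V"
    by (simp add: matrix_vector_mult_basis)
  have "transpose V *v column p V = axis p 1"
    by (simp add: col[symmetric] matrix_vector_mul_assoc VtV)
  then have "(norm (M *v column p V))\<^sup>2 = (\<Sum>j\<in>UNIV. if j = p then d $ p else 0)"
    unfolding sq by (intro sum.cong) (auto simp: axis_def)
  then have Mp: "(norm (M *v column p V))\<^sup>2 = d $ p" by simp
  have z: "z = V *v y"
    unfolding y_def by (simp only: matrix_vector_mul_assoc VVt matrix_vector_mul_lid)
  have "(norm z)\<^sup>2 = (norm y)\<^sup>2"
    unfolding power2_norm_eq_inner
    using adjoint[of y z] unfolding z[symmetric] y_def[symmetric] .
  also have "\<dots> = (\<Sum>j\<in>UNIV. (y $ j)\<^sup>2)"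
    by (simp only: power2_norm_eq_inner inner_vec_def) (simp add: power2_eq_square)
  finally have nz: "(norm z)\<^sup>2 = (\<Sum>j\<in>UNIV. (y $ j)\<^sup>2)" .
  have "(norm (M *v z))\<^sup>2 \<le> d $ p * (norm z)\<^sup>2"
    using power_mono[OF le, of 2] by (simp add: power_mult_distrib Mp)
  then have "(\<Sum>j\<in>UNIV. (d $ j - d $ p) * (y $ j)\<^sup>2) \<le> 0"
    unfolding nz sq y_def[symmetric]
    by (simp add: left_diff_distrib sum_subtractf sum_distrib_left)
  moreover have nonneg: "0 \<le> (d $ j - d $ p) * (y $ j)\<^sup>2" for j
    using gap[of j] by (cases "j = p") auto
  ultimately have "(\<Sum>j\<in>UNIV. (d $ j - d $ p) * (y $ j)\<^sup>2) = 0"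
    by (intro antisym sum_nonneg) auto
  then have "\<forall>j. (d $ j - d $ p) * (y $ j)\<^sup>2 = 0"
    using nonneg by (simp add: sum_nonneg_eq_0_iff)
  then have "y $ j = 0" if "j \<noteq> p" for j
    using gap[OF that] by (metis diff_gt_0_iff_gt less_irrefl mult_eq_0_iff power2_eq_square)
  then have "y = (y $ p) *\<^sub>R axis p 1"
    by (auto simp: vec_eq_iff axis_def)
  then have "z = (y $ p) *\<^sub>R column p V"
    using z by (metis col matrix_vector_mult_scaleR)
  then show ?thesis by (simp add: y_def)
qed

section \<open>Inverting the shifted Gram matrix\<close>

text \<open>
  Both parts are \<open>V\<^sup>T V = I\<close> read blockwise: the first for two of the leading columns, the second
  for a leading column and the last one.
\<close>

lemma leading_block_orthogonality:
  fixes V :: "real^('n::finite option)^('n option)"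
  assumes V: "orthogonal_matrix V"
  shows "transpose (leading_block V) ** leading_block V
           + outer (\<chi> j. V $ None $ Some j) (\<chi> j. V $ None $ Some j) = mat 1"
    and "transpose (leading_block V) *v (\<chi> i. V $ Some i $ None)
           = - (V $ None $ None) *\<^sub>R (\<chi> j. V $ None $ Some j)"
proof -
  have VtV: "transpose V ** V = mat 1" using V by (simp add: orthogonal_matrix_def)
  have *: "V $ None $ j * V $ None $ k + (\<Sum>i\<in>UNIV. V $ Some i $ j * V $ Some i $ k)
        = (if j = k then 1 else 0)" for j k
  proof -
    have "(transpose V ** V) $ j $ k = (if j = k then 1 else 0)"
      by (simp add: VtV mat_def)
    then show ?thesis
      by (simp add: matrix_matrix_mult_def transpose_def sum_UNIV_option)
  qed
  show "transpose (leading_block V) ** leading_block V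
      + outer (\<chi> j. V $ None $ Some j) (\<chi> j. V $ None $ Some j) = mat 1"
    using *[of "Some _" "Some _"]
    by (simp add: vec_eq_iff matrix_matrix_mult_def transpose_def leading_block_def outer_def
        mat_def add.commute)
  show "transpose (leading_block V) *v (\<chi> i. V $ Some i $ None)
      = - (V $ None $ None) *\<^sub>R (\<chi> j. V $ None $ Some j)"
    using *[of "Some _" None]
    by (simp add: vec_eq_iff matrix_vector_mult_def transpose_def leading_block_def
        eq_neg_iff_add_eq_0 algebra_simps)
qed

text \<open>
  If the corner entry were zero, the rest of the last column would be orthogonal to the columns
  of the invertible leading block, so the whole unit column would vanish.
\<close>

lemma corner_nonzero:
  fixes V :: "real^('n::finite option)^('n option)"
  assumes V: "orthogonal_matrix V" and inv: "invertible (leading_block V)"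
  shows "V $ None $ None \<noteq> 0"
proof
  assume 0: "V $ None $ None = 0"
  define u where "u = (\<chi> i. V $ Some i $ None)"
  have "transpose (leading_block V) *v u = 0"
    using leading_block_orthogonality(2)[OF V] 0 by (simp add: u_def)
  moreover have "invertible (transpose (leading_block V))"
    using inv by (simp add: invertible_det_nz det_transpose)
  ultimately have "u = 0"
    by (simp add: invertible_left_inverse matrix_left_invertible_ker)
  then have "V $ j $ None = 0" for j
    using 0 by (cases j) (auto simp: vec_eq_iff u_def)
  then have "column None V = 0"
    by (simp add: vec_eq_iff column_def)
  moreover have "norm (column None V) = 1"
    using V by (simp add: orthogonal_matrix_orthonormal_columns)
  ultimately show False by simp
qed

lemma matrix_add_rdistrib: "(A + B) ** C = A ** C + B ** (C :: real^'k^'n)"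
  by (simp add: vec_eq_iff matrix_matrix_mult_def sum.distrib distrib_right)

text \<open>
  Scaling the last column of \<open>V\<close> to \<open>(x, -1)\<close> turns its orthogonality to the other columns into
  \<open>W\<^sup>T x = w\<close>, where \<open>w\<close> is the last row of \<open>V\<close> without its corner. Hence the term
  \<open>W\<^sup>T (x x\<^sup>T) W = w w\<^sup>T\<close> is exactly the defect of \<open>W\<^sup>T W\<close> from the identity.
\<close>

lemma bordered_inverse:
  fixes V :: "real^('n::finite option)^('n option)"
  assumes V: "orthogonal_matrix V" and inv: "invertible (leading_block V)"
    and x: "border x (- 1) = c *\<^sub>R column None V"
  shows "transpose (leading_block V) ** (mat 1 + outer x x) ** leading_block V = mat 1"
proof -
  define W where "W = leading_block V"
  define u where "u = (\<chi> i. V $ Some i $ None)"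
  define w where "w = (\<chi> j. V $ None $ Some j)"
  have "c * V $ None $ None = - 1"
    using arg_cong[OF x, of "\<lambda>z. z $ None"] by (simp add: column_def)
  moreover have "x = c *\<^sub>R u"
    using arg_cong[OF x, of "\<lambda>z. z $ Some _"] by (simp add: vec_eq_iff column_def u_def)
  ultimately have Wx: "transpose W *v x = w"
    using leading_block_orthogonality(2)[OF V]
    by (simp add: matrix_vector_mult_scaleR W_def u_def w_def)
  have "transpose W ** outer x x ** W = outer (transpose W *v x) (transpose W *v x)"
    by (simp add: vec_eq_iff matrix_matrix_mult_def matrix_vector_mult_def transpose_def outer_def
        sum_distrib_left sum_distrib_right mult_ac)
  then show ?thesis
    using leading_block_orthogonality(1)[OF V] Wx
    by (simp add: matrix_add_ldistrib matrix_add_rdistrib W_def w_def)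
qed

lemma matrix_inv_right:
  assumes "invertible (M :: real^'n^'n)"
  shows "M ** matrix_inv M = mat 1"
  using someI_ex[OF assms[unfolded invertible_def]] by (simp add: matrix_inv_def)

lemma matrix_inv_unique:
  fixes M :: "real^'n^'n"
  assumes "N ** M = mat 1"
  shows "matrix_inv M = N"
proof -
  have "invertible M" using assms by (auto simp: invertible_left_inverse)
  then have "N ** (M ** matrix_inv M) = N" by (simp add: matrix_inv_right)
  then show ?thesis by (simp add: matrix_mul_assoc assms)
qed

text \<open>
  The assumption on \<open>W\<close> says that \<open>W\<^sup>T Q\<^sub>1\<close> is the inverse of \<open>W\<close>. Regrouped, it says
  that \<open>Q\<^sub>1 W\<close> is the inverse of \<open>W\<^sup>T\<close>. The right-hand side is thus the product of the inverses
  of the three factors in reverse order.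
\<close>

lemma matrix_inv_congruence:
  fixes W D Q1 :: "real^'n^'n"
  assumes D: "invertible D" and W: "transpose W ** Q1 ** W = mat 1"
  shows "matrix_inv (W ** D ** transpose W) = Q1 ** (W ** matrix_inv D ** transpose W) ** Q1"
proof (rule matrix_inv_unique, subst matrix_left_right_inverse)
  have W': "W ** (transpose W ** Q1) = mat 1"
    using W by (simp add: matrix_left_right_inverse)
  have "W ** D ** transpose W ** (Q1 ** (W ** matrix_inv D ** transpose W) ** Q1)
      = W ** (D ** (transpose W ** Q1 ** W) ** matrix_inv D) ** (transpose W ** Q1)"
    by (simp add: matrix_mul_assoc)
  also have "\<dots> = mat 1"
    using D by (simp add: W W' matrix_inv_right)
  finally show "W ** D ** transpose W ** (Q1 ** (W ** matrix_inv D ** transpose W) ** Q1) = mat 1" .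
qed

lemma invertible_diag_mat_nth_nonzero:
  assumes "invertible (diag_mat d)"
  shows "d $ j \<noteq> 0"
proof
  assume "d $ j = 0"
  then have "diag_mat d *v axis j 1 = 0"
    by (auto simp: vec_eq_iff diag_mat_mult_vector_nth axis_def)
  then have "axis j (1::real) = 0"
    using assms by (auto simp: invertible_left_inverse matrix_left_invertible_ker)
  then show False by (simp add: axis_eq_0_iff)
qed

text \<open>
  The factorisation \<open>P = W D W\<^sup>T\<close> is used twice: its invertibility yields the spectral gap and
  the nonzero corner that identify \<open>(x, -1)\<close> with a multiple of the last column of \<open>V\<close>, and
  inverting its three factors yields the formula.
\<close>

lemma matrix_inv_shifted_gram:
  fixes A :: "real^('n::{finite,linorder})^('m::{finite,linorder})"
    and V :: "real^('n option)^('n option)"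
  assumes m_gt_n: "CARD('m) > CARD('n)"
    and svd: "is_svd (append_col A b) U \<sigma> V"
    and generic: "\<sigma> (CARD('n) + 1) < smallest_singular_value A"
    and tls: "is_tls_solution A b x"
    and D_def: "D = diag_mat (\<chi> j. (\<sigma> (idx j))\<^sup>2 - (\<sigma> (CARD('n) + 1))\<^sup>2)"
  shows "matrix_inv (transpose A ** A - (\<sigma> (CARD('n) + 1))\<^sup>2 *\<^sub>R mat 1)
         = (mat 1 + outer x x)
             ** (leading_block V ** matrix_inv D ** transpose (leading_block V))
             ** (mat 1 + outer x x)"
proof -
  define s where "s = \<sigma> (CARD('n) + 1)"
  define d where "d = (\<chi> j :: 'n option. (\<sigma> (aug_idx j))\<^sup>2)"
  define W where "W = leading_block V"
  have V: "orthogonal_matrix V" and s: "0 \<le> s"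
    using svd by (auto simp: is_svd_def s_def)
  have gram: "transpose (append_col A b) ** append_col A b = V ** diag_mat d ** transpose V"
    using gram_svd[OF m_gt_n svd] by (simp add: d_def)
  have dN: "d $ None = s\<^sup>2"
    by (simp add: d_def s_def aug_idx_def)
  have D: "D = diag_mat (\<chi> j. d $ Some j - d $ None)"
    unfolding D_def dN by (simp add: d_def s_def aug_idx_def)
  have P: "transpose A ** A - s\<^sup>2 *\<^sub>R mat 1 = W ** D ** transpose W"
    using leading_block_shifted[OF V, of d] leading_block_gram_append_col[of A b]
    by (simp add: gram dN D W_def)
  have "det (W ** D ** transpose W) \<noteq> 0"
    using invertible_shifted_gram[of s A] s generic P by (simp add: s_def invertible_det_nz)
  then have W_inv: "invertible W" and D_inv: "invertible D"
    by (auto simp: det_mul invertible_det_nz)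
  \<comment> \<open>The ordering of the singular values gives only a weak inequality; it is strict because
      \<open>D\<close> is invertible.\<close>
  have gap: "d $ None < d $ j" if "j \<noteq> None" for j
  proof -
    from that obtain l where l: "j = Some l" by auto
    have "s \<le> \<sigma> (aug_idx j)"
      using svd aug_idx_bounds[of j] by (auto simp: is_svd_def s_def)
    then have "d $ None \<le> d $ j"
      unfolding dN using s by (simp add: d_def power_mono)
    moreover have "d $ j - d $ None \<noteq> 0"
      using invertible_diag_mat_nth_nonzero[of "\<chi> j. d $ Some j - d $ None" l] D_inv D l by simp
    ultimately show ?thesis by simp
  qed
  define v where "v = column None V"
  have "norm v = 1" and "v $ None \<noteq> 0"
    using V corner_nonzero[OF V] W_inv
    by (simp_all add: v_def W_def column_def orthogonal_matrix_orthonormal_columns)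
  from tls_solution_minimises_quotient[OF tls this]
  have "border x (- 1) = ((transpose V *v border x (- 1)) $ None) *\<^sub>R column None V"
    by (intro bottom_eigenspace[OF gram V gap]) (simp_all add: v_def)
  then have "transpose W ** (mat 1 + outer x x) ** W = mat 1"
    unfolding W_def by (rule bordered_inverse[OF V W_inv[unfolded W_def]])
  from matrix_inv_congruence[OF D_inv this] show ?thesis
    by (simp only: P[unfolded s_def] W_def)
qed

section \<open>The condition numbers\<close>


theorem corollary3p9:
  fixes \<S> :: "(real^('n::{finite,linorder})^('m::{finite,linorder})) set"
    and S :: "nat \<Rightarrow> real^('n::{finite,linorder})^('m::{finite,linorder})"
    and a :: "nat \<Rightarrow> real"
    and q :: nat
    and A :: "real^('n::{finite,linorder})^('m::{finite,linorder})"
    and b r :: "real^('m::{finite,linorder})"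
    and x :: "real^('n::{finite,linorder})"
    and L :: "real^('n::{finite,linorder})^'k"
    and U :: "real^('m::{finite,linorder})^('m::{finite,linorder})"
    and V :: "real^('n option)^('n option)"
    and \<sigma> :: "nat \<Rightarrow> real"
    and V11 D Q1 Q :: "real^('n::{finite,linorder})^('n::{finite,linorder})"
  assumes m_gt_n: "CARD('m) > CARD('n)"
    and k_le_n: "CARD('k) \<le> CARD('n)"
    and subspace: "subspace \<S>"
    and basis: "inj_on S {1..q}" "independent (S ` {1..q})" "span (S ` {1..q}) = \<S>"
    and A_def: "A = (\<Sum>i=1..q. a i *\<^sub>R S i)"
    and svd: "is_svd (append_col A b) U \<sigma> V"
    and generic: "smallest_singular_value A > \<sigma> (CARD('n) + 1)"
    and tls: "is_tls_solution A b x"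
    and r_def: "r = b - A *v x"
    and V11_def: "V11 = leading_block V"
    and D_def: "D = diag_mat (\<chi> j. (\<sigma> (idx j))\<^sup>2 - (\<sigma> (CARD('n) + 1))\<^sup>2)"
    and Q1_def: "Q1 = mat 1 + outer x x"
    and Q_def: "Q = V11 ** matrix_inv D ** transpose V11"
  shows "(L *v x \<noteq> 0 \<longrightarrow>
           kappa_s_inf_rel L q S a A b (\<sigma> (CARD('n) + 1)) x =
             infnorm
               ((\<Sum>i=1..q. \<bar>a i\<bar> *\<^sub>R
                   \<bar>(L ** Q1 ** Q ** Q1) *v
                     ((transpose A + (2 / (1 + x \<bullet> x)) *\<^sub>R outer x r) *v (S i *v x)
                       - transpose (S i) *v r)\<bar>)
                + \<bar>L ** Q1 ** Q ** Q1 ** (transpose A + (2 / (1 + x \<bullet> x)) *\<^sub>R outer x r)\<bar> *v \<bar>b\<bar>)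
             / infnorm (L *v x))
       \<and> kappa_s_c L q S a A b (\<sigma> (CARD('n) + 1)) x =
           infnorm
             (pinv (diag_mat (L *v x)) *v
                (\<Sum>i=1..q. \<bar>a i\<bar> *\<^sub>R
                   \<bar>(L ** Q1 ** Q ** Q1) *v
                     ((transpose A + (2 / (1 + x \<bullet> x)) *\<^sub>R outer x r) *v (S i *v x)
                       - transpose (S i) *v r)\<bar>)
              + (pinv (diag_mat (L *v x))
                   ** \<bar>L ** Q1 ** Q ** Q1 ** (transpose A + (2 / (1 + x \<bullet> x)) *\<^sub>R outer x r)\<bar>)
                  *v \<bar>b\<bar>)"
proof -
  let ?K = "transpose A + (2 / (1 + x \<bullet> x)) *\<^sub>R outer x r"
  have "matrix_inv (transpose A ** A - (\<sigma> (CARD('n) + 1))\<^sup>2 *\<^sub>R mat 1) = Q1 ** Q ** Q1"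
    using matrix_inv_shifted_gram[OF m_gt_n svd generic tls D_def]
    by (simp add: Q1_def Q_def V11_def)
  then have w: "tls_w L q S a A b (\<sigma> (CARD('n) + 1)) x =
      (\<Sum>i=1..q. \<bar>a i\<bar> *\<^sub>R
         \<bar>(L ** Q1 ** Q ** Q1) *v (?K *v (S i *v x) - transpose (S i) *v r)\<bar>)
      + \<bar>L ** Q1 ** Q ** Q1 ** ?K\<bar> *v \<bar>b\<bar>"
    by (simp add: tls_w_def Let_def r_def matrix_mul_assoc)
  show ?thesis
    unfolding kappa_s_inf_rel_def kappa_s_c_def w
    by (simp add: matrix_vector_right_distrib matrix_vector_mul_assoc)
qed

end
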